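(* Let $V_1,V_2,V_3,V_4$ be $3$-dimensional complex vector spaces and let $G=\mathfrak{S}_4\ltimes \mathrm{GL}(3)^{\times 4}$. Suppose $Q\in V_1\otimes V_2\otimes V_3\otimes V_4$ is a quadrifocal tensor. Then the $600$ cubic polynomials forming a basis of the $G$-module $S_{3}S_{3}S_{1,1,1}S_{1,1,1}\subset S^3(V_1^*\otimes V_2^*\otimes V_3^*\otimes V_4^* )$ vanish on $Q$.
   Context: The ground field is $\mathbb{C}$. Given four $3\times 4$ matrices $A_1,A_2,A_3,A_4$ of full rank (camera matrices), form the $4\times 12$ block matrix $A=(A_1^{\top}\mid A_2^{\top}\mid A_3^{\top}\mid A_4^{\top})$. For $1\le i,j,k,l\le 3$ let $Q_{i,j,k,l}(A)$ be the $4\times 4$ minor of $A$ formed by column $i$ of block $1$, column $j$ of block $2$, column $k$ of block $3$ and column $l$ of block $4$ (in this order). Fixing bases $V_i\cong\mathbb{C}^3$, a quadrifocal tensor is a tensor of the form $Q(A)=(Q_{i,j,k,l}(A))\in V_1\otimes V_2\otimes V_3\otimes V_4$. $S^3(V_1^*\otimes V_2^*\otimes V_3^*\otimes V_4^* )$ is the space of homogeneous cubic polynomials on $V_1\otimes V_2\otimes V_3\otimes V_4$. $S_\pi$ denotes the Schur functor of the partition $\pi$, so $S_3V=S^3V$ is the symmetric cube and $S_{1,1,1}V=\bigwedge^3V$. The notation $S_{3}S_{3}S_{1,1,1}S_{1,1,1}$ means the direct sum of $S_3V_1^*\otimes S_3V_2^*\otimes S_{1,1,1}V_3^*\otimes S_{1,1,1}V_4^*$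 and all its distinct copies under permutation of the four indices, i.e. the direct sum, over the six ways of splitting $\{1,2,3,4\}=\{i,j\}\sqcup\{k,l\}$ into an ordered pair of $2$-element subsets, of the $100$-dimensional $\mathrm{GL}(3)^{\times4}$-modules $\bigwedge^3V_i^*\otimes\bigwedge^3V_j^*\otimes S^3V_k^*\otimes S^3V_l^*$, each of which occurs with multiplicity one in $S^3(V_1^*\otimes V_2^*\otimes V_3^*\otimes V_4^* )$. Explicitly, the summand for $\{i,j\}=\{1,2\}$, $\{k,l\}=\{3,4\}$ is spanned by the coefficients, viewed as cubic polynomials in the entries $Q_{p,q,r,s}$ of $Q$, of the bihomogeneous form of bidegree $(3,3)$ in the variables $a=(a_1,a_2,a_3)$ and $x=(x_1,x_2,x_3)$ given by $$\det\Bigl(\sum_{r,s=1}^{3} a_r x_s\, Q_{p,q,r,s}\Bigr)_{1\le p,q\le 3},$$ and the other five summands are obtained in the same way by permuting the roles of the four tensor factors. *)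

theory Defs
  imports "HOL-Analysis.Analysis" "HOL-Library.Poly_Mapping"
begin

text \<open>
  Coordinates with respect to fixed bases: an element of \<open>V\<^sub>1 \<otimes> V\<^sub>2 \<otimes> V\<^sub>3 \<otimes> V\<^sub>4\<close> is its family of
  entries, and a multi-index \<open>I :: 4 \<Rightarrow> 3\<close> has \<open>I c\<close> as its index in the tensor factor \<open>c\<close>.
  In the numeral types \<open>3\<close> and \<open>4\<close> the last element is \<open>3 = 0\<close>, respectively \<open>4 = 0\<close>.
\<close>

type_synonym multi_index = "4 \<Rightarrow> 3"
type_synonym tensor = "multi_index \<Rightarrow> complex"

definition block_matrix :: "(4 \<Rightarrow> complex^4^3) \<Rightarrow> complex^(4 \<times> 3)^4" where
  "block_matrix A = (\<chi> m cn. transpose (A (fst cn)) $ m $ snd cn)"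

definition quadrifocal_of :: "(4 \<Rightarrow> complex^4^3) \<Rightarrow> tensor" where
  "quadrifocal_of A = (\<lambda>I. det (\<chi> m c. block_matrix A $ m $ (c, I c)))"

definition quadrifocal :: "tensor \<Rightarrow> bool" where
  "quadrifocal Q \<longleftrightarrow> (\<exists>A. (\<forall>c. rank (A c) = 3) \<and> Q = quadrifocal_of A)"

text \<open>
  \<open>('v, 'a) mpoly\<close> is the polynomial ring over \<open>'a\<close> in the variables \<open>'v\<close>: monomials are
  exponent vectors, and the ring structure is the convolution product of \<^theory>\<open>HOL-Library.Poly_Mapping\<close>.
\<close>

type_synonym ('v, 'a) mpoly = "('v \<Rightarrow>\<^sub>0 nat) \<Rightarrow>\<^sub>0 'a"

definition mvar :: "'v \<Rightarrow> ('v, 'a::comm_ring_1) mpoly" where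
  "mvar v = Poly_Mapping.single (Poly_Mapping.single v 1) 1"

definition mconst :: "'a::comm_ring_1 \<Rightarrow> ('v, 'a) mpoly" where
  "mconst c = Poly_Mapping.single 0 c"

definition meval :: "('v::finite, 'a::comm_ring_1) mpoly \<Rightarrow> ('v \<Rightarrow> 'a) \<Rightarrow> 'a" where
  "meval f x = (\<Sum>m\<in>Poly_Mapping.keys f. Poly_Mapping.lookup f m * (\<Prod>v\<in>UNIV. x v ^ Poly_Mapping.lookup m v))"

type_synonym tensor_poly = "(multi_index, complex) mpoly"

global_interpretation tpoly: vector_space "\<lambda>c (f :: tensor_poly). mconst c * f"
  by unfold_locales
    (simp_all add: mconst_def algebra_simps single_add mult_single flip: mult.assoc)

definition cubic_forms :: "tensor_poly set" where
  "cubic_forms = {f. \<forall>m\<in>Poly_Mapping.keys f. (\<Sum>I\<in>UNIV. Poly_Mapping.lookup m I) = 3}"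

text \<open>
  For distinct \<open>i, j, k, l\<close>: the determinant over the indices of the factors \<open>i\<close> and \<open>j\<close>, after
  contracting the factor \<open>k\<close> with \<open>a\<close> and the factor \<open>l\<close> with \<open>x\<close>. It is a polynomial in
  \<open>a\<^sub>r = mvar (Inl r)\<close> and \<open>x\<^sub>s = mvar (Inr s)\<close> whose coefficients are polynomials in the entries
  of a generic tensor.
\<close>

definition det_form :: "4 \<Rightarrow> 4 \<Rightarrow> 4 \<Rightarrow> 4 \<Rightarrow> (3 + 3, tensor_poly) mpoly" where
  "det_form i j k l =
    det (\<chi> p q. \<Sum>r\<in>UNIV. \<Sum>s\<in>UNIV.
      mvar (Inl r) * mvar (Inr s) * mconst (mvar ((\<lambda>_. 0)(i := p, j := q, k := r, l := s))))"

text \<open>\<open>\<And>\<^sup>3V\<^sub>i\<^sup>* \<otimes> \<And>\<^sup>3V\<^sub>j\<^sup>* \<otimes> S\<^sup>3V\<^sub>k\<^sup>* \<otimes> S\<^sup>3V\<^sub>l\<^sup>*\<close> as a space of cubic polynomials.\<close>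

definition summand :: "4 \<Rightarrow> 4 \<Rightarrow> 4 \<Rightarrow> 4 \<Rightarrow> tensor_poly set" where
  "summand i j k l = tpoly.span (range (Poly_Mapping.lookup (det_form i j k l)))"

text \<open>
  The sum of the summands over all splittings \<open>{i, j}, {k, l}\<close>. A summand does not change when
  \<open>i, j\<close> or \<open>k, l\<close> are exchanged, so the 24 arrangements yield six subspaces.
\<close>

definition S3_S3_S111_S111 :: "tensor_poly set" where
  "S3_S3_S111_S111 = tpoly.span (\<Union>{summand i j k l | i j k l. distinct [i, j, k, l]})"

text \<open>
  The transformation of the tensor space given by an element of the semidirect product of the
  symmetric group on the four factors and \<open>GL(3)\<^sup>4\<close>: first permute the factors, then act on each.
\<close>

definition tensor_act :: "(4 \<Rightarrow> 4) \<Rightarrow> (4 \<Rightarrow> complex^3^3) \<Rightarrow> tensor \<Rightarrow> tensor" where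
  "tensor_act \<pi> g T = (\<lambda>J. \<Sum>I\<in>UNIV. (\<Prod>c\<in>UNIV. g c $ J c $ I c) * T (I \<circ> \<pi>))"

text \<open>
  The group acts on polynomials by \<open>f \<mapsto> f \<circ> \<gamma>\<^sup>-\<^sup>1\<close>; as \<open>\<gamma>\<close> ranges over the whole group, the inverse
  can be dropped. The polynomial \<open>h\<close> is determined by its values, the ground field being infinite.
\<close>

definition G_submodule :: "tensor_poly set \<Rightarrow> bool" where
  "G_submodule W \<longleftrightarrow> tpoly.subspace W \<and>
    (\<forall>\<pi> g. \<pi> permutes UNIV \<longrightarrow> (\<forall>c. invertible (g c)) \<longrightarrow>
      (\<forall>f\<in>W. \<exists>h\<in>W. \<forall>T. meval h T = meval f (tensor_act \<pi> g T)))"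

end

theory Submission
  imports Defs
begin

text \<open>
  All determinants are taken in the polynomial ring \<open>\<complex>[a, x]\<close>, so that coefficients can be compared directly.

  For a quadrifocal tensor, the contracted matrix has the entries \<open>\<omega>(y\<^sub>p, z\<^sub>q) = det(y\<^sub>p, z\<^sub>q, u, v)\<close>, where \<open>y\<^sub>p\<close> and
  \<open>z\<^sub>q\<close> are the rows of two cameras and \<open>u\<close>, \<open>v\<close> are the contracted rows of the other two. The form \<open>\<omega>\<close> is a
  decomposable alternating form, hence of rank two, so the \<open>3 \<times> 3\<close> determinant vanishes; over a ring this is
  a consequence of the three-term Pluecker relation.

  The group acts on the form \<open>D(a, x)\<close> of a summand by a permutation of the factors, a scalar
  \<open>det g\<^sub>i det g\<^sub>j\<close> and a linear substitution in \<open>a\<close> and \<open>x\<close>, which yields the submodule property.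

  For the dimension, evaluate at \<open>T(u, v) = \<Sum>\<^sub>t e\<^sub>t \<otimes> e\<^sub>t \<otimes> e\<^bsub>u(t)\<^esub> \<otimes> e\<^bsub>v(t)\<^esub>\<close>. The form of the summand
  \<open>{i, j}, {k, l}\<close> becomes the monomial \<open>\<Prod>\<^sub>t a\<^bsub>u(t)\<^esub> x\<^bsub>v(t)\<^esub>\<close>, while the form of any other summand is
  alternating under permutations of \<open>u\<close> or of \<open>v\<close>. Symmetrising the evaluation over a transposition in \<open>u\<close> and in
  \<open>v\<close> thus gives functionals dual to the \<open>6 \<cdot> 10 \<cdot> 10\<close> coefficients.
\<close>

subsection \<open>Evaluation of polynomials\<close>

lemma lookup_mconst_mult [simp]:
  "Poly_Mapping.lookup (mconst c * f) m = c * Poly_Mapping.lookup f m"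
  unfolding mconst_def by (simp flip: mult_map_scale_conv_mult add: Poly_Mapping.map.rep_eq when_def)

lemma lookup_mult_mconst [simp]:
  "Poly_Mapping.lookup (f * mconst c) m = Poly_Mapping.lookup f m * c"
  by (metis lookup_mconst_mult mult.commute)

lemma mconst_0 [simp]: "mconst 0 = 0"
  by (simp add: mconst_def)

lemma mconst_1 [simp]: "mconst 1 = 1"
  by (simp add: mconst_def)

lemma mconst_add: "mconst (a + b) = mconst a + mconst b"
  by (simp add: mconst_def single_add)

lemma mconst_mult: "mconst (a * b) = mconst a * mconst b"
  by (simp add: mconst_def mult_single)

lemma mconst_sum: "mconst (sum f A) = (\<Sum>i\<in>A. mconst (f i))"
  by (induction A rule: infinite_finite_induct) (simp_all add: mconst_add)

lemma prod_single_one: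
  "(\<Prod>i\<in>A. Poly_Mapping.single (f i) (1::'a::comm_semiring_1)) = Poly_Mapping.single (\<Sum>i\<in>A. f i) 1"
  by (induction A rule: infinite_finite_induct) (simp_all add: mult_single)

lemma poly_mapping_sum_single:
  "f = (\<Sum>m\<in>Poly_Mapping.keys f. Poly_Mapping.single m (Poly_Mapping.lookup f m))"
  by (rule poly_mapping_eqI)
    (simp add: lookup_sum lookup_single when_def not_in_keys_iff_lookup_eq_zero)

lemma meval_superset:
  assumes "finite S" and "Poly_Mapping.keys f \<subseteq> S"
  shows "meval f x = (\<Sum>m\<in>S. Poly_Mapping.lookup f m * (\<Prod>v\<in>UNIV. x v ^ Poly_Mapping.lookup m v))"
  unfolding meval_def
  by (rule sum.mono_neutral_left) (use assms in \<open>auto simp: in_keys_iff\<close>)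

lemma meval_0 [simp]: "meval 0 x = 0"
  by (simp add: meval_def)

lemma meval_add: "meval (f + g) x = meval f x + meval g x"
proof -
  let ?S = "Poly_Mapping.keys f \<union> Poly_Mapping.keys g"
  have "Poly_Mapping.keys (f + g) \<subseteq> ?S"
    by (rule keys_add)
  then show ?thesis
    by (simp add: meval_superset[of ?S] lookup_add distrib_right sum.distrib)
qed

lemma meval_sum: "meval (sum f A) x = (\<Sum>i\<in>A. meval (f i) x)"
  by (induction A rule: infinite_finite_induct) (simp_all add: meval_add)

lemma meval_single:
  "meval (Poly_Mapping.single m c) x = c * (\<Prod>v\<in>UNIV. x v ^ Poly_Mapping.lookup m v)"
  by (subst meval_superset[of "{m}"]) simp_all

lemma meval_mvar [simp]: "meval (mvar v) x = x v"
proof -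
  have "(\<Prod>w\<in>UNIV. x w ^ Poly_Mapping.lookup (Poly_Mapping.single v (1::nat)) w)
      = (\<Prod>w\<in>UNIV. if w = v then x w else 1)"
    by (rule prod.cong) (auto simp: lookup_single when_def)
  then show ?thesis
    by (simp add: mvar_def meval_single)
qed

lemma meval_mconst [simp]: "meval (mconst c) x = c"
  by (simp add: mconst_def meval_single)

text \<open>By bilinearity it suffices to treat single terms, where exponents add.\<close>

lemma meval_mult: "meval (f * g) x = meval f x * meval g x"
proof -
  have mono: "meval (Poly_Mapping.single m c * Poly_Mapping.single n d) x
      = meval (Poly_Mapping.single m c) x * meval (Poly_Mapping.single n d) x" for m n c d
    by (simp add: mult_single meval_single lookup_add power_add prod.distrib)
  let ?s = "\<lambda>f m. Poly_Mapping.single m (Poly_Mapping.lookup f m)"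
  have "meval (sum (?s f) (Poly_Mapping.keys f) * sum (?s g) (Poly_Mapping.keys g)) x
      = meval (sum (?s f) (Poly_Mapping.keys f)) x * meval (sum (?s g) (Poly_Mapping.keys g)) x"
    by (simp add: sum_product meval_sum mono)
  then show ?thesis
    by (simp flip: poly_mapping_sum_single)
qed

lemma meval_1 [simp]: "meval 1 x = 1"
  by (metis mconst_1 meval_mconst)

text \<open>A determinant is an integer polynomial in its entries, so every ring homomorphism
  commutes with it. Used for the embedding \<open>mconst\<close> of constants and for
  evaluation.\<close>

lemma ring_hom_det:
  fixes h :: "'a::comm_ring_1 \<Rightarrow> 'b::comm_ring_1" and M :: "'a^'n^'n"
  assumes add: "\<And>a b. h (a + b) = h a + h b" and mult: "\<And>a b. h (a * b) = h a * h b"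
    and one: "h 1 = 1"
  shows "h (det M) = det (\<chi> i j. h (M $ i $ j))"
proof -
  have zero: "h 0 = 0"
    using add[of 0 0] by simp
  have neg: "h (- a) = - h a" for a
    using add[of a "- a"] zero by (simp add: eq_neg_iff_add_eq_0 add.commute)
  have sum: "h (sum f A) = (\<Sum>i\<in>A. h (f i))" for f :: "('n \<Rightarrow> 'n) \<Rightarrow> 'a" and A
    by (induction A rule: infinite_finite_induct) (simp_all add: zero add)
  have prod: "h (prod f A) = (\<Prod>i\<in>A. h (f i))" for f :: "'n \<Rightarrow> 'a" and A
    by (induction A rule: infinite_finite_induct) (simp_all add: one mult)
  have "h (of_int (sign p)) = of_int (sign p)" for p :: "'n \<Rightarrow> 'n"
    by (simp add: sign_def one neg)
  then show ?thesis
    by (simp add: det_def sum mult prod)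
qed

lemma mconst_det: "mconst (det M) = det (\<chi> i j. mconst (M $ i $ j))"
  by (rule ring_hom_det) (simp_all add: mconst_add mconst_mult)

lemma meval_det: "meval (det M) x = det (\<chi> i j. meval (M $ i $ j) x)"
  by (rule ring_hom_det) (simp_all add: meval_add meval_mult)

subsection \<open>The contracted determinant\<close>

text \<open>The contracting vectors \<alpha>, \<beta> are arbitrary: the variables themselves give
  the form of a summand, linear forms in them give its image under a group element.\<close>

definition contracted_matrix ::
    "(3 \<Rightarrow> ('v, 'a::comm_ring_1) mpoly) \<Rightarrow> (3 \<Rightarrow> ('v, 'a) mpoly) \<Rightarrow> (3 \<Rightarrow> 3 \<Rightarrow> 3 \<Rightarrow> 3 \<Rightarrow> 'a) \<Rightarrow> ('v, 'a) mpoly^3^3" where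
  "contracted_matrix \<alpha> \<beta> E = (\<chi> p q. \<Sum>r\<in>UNIV. \<Sum>s\<in>UNIV. \<alpha> r * \<beta> s * mconst (E p q r s))"

text \<open>The indices \<open>r\<close> and \<open>s\<close> of the contracted factors may vary with the row.\<close>

definition row_det :: "(3 \<Rightarrow> 3 \<Rightarrow> 3 \<Rightarrow> 3 \<Rightarrow> 'a::comm_ring_1) \<Rightarrow> (3 \<Rightarrow> 3) \<Rightarrow> (3 \<Rightarrow> 3) \<Rightarrow> 'a" where
  "row_det E r s = det (\<chi> p q. E p q (r p) (s p))"

text \<open>Multilinearity in the rows: each row is a sum over pairs of indices, so the expansion
  chooses one pair \<open>r p\<close>, \<open>s p\<close> for every row \<open>p\<close>.\<close>

lemma det_contracted_matrix:
  "det (contracted_matrix \<alpha> \<beta> E) =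
    (\<Sum>r\<in>UNIV. \<Sum>s\<in>UNIV. (\<Prod>p\<in>UNIV. \<alpha> (r p) * \<beta> (s p)) * mconst (row_det E r s))"
proof -
  have "det (contracted_matrix \<alpha> \<beta> E)
      = det (\<chi> p. \<Sum>r\<in>UNIV. \<Sum>s\<in>UNIV. (\<alpha> r * \<beta> s) *s (\<chi> q. mconst (E p q r s)))"
    unfolding contracted_matrix_def
    by (rule arg_cong[where f = det]) (simp add: vec_eq_iff)
  also have "\<dots> = (\<Sum>r\<in>UNIV. \<Sum>s\<in>UNIV.
      det (\<chi> p. (\<alpha> (r p) * \<beta> (s p)) *s (\<chi> q. mconst (E p q (r p) (s p)))))"
    by (simp add: det_linear_rows_sum)
  also have "\<dots> = (\<Sum>r\<in>UNIV. \<Sum>s\<in>UNIV. (\<Prod>p\<in>UNIV. \<alpha> (r p) * \<beta> (s p)) * mconst (row_det E r s))"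
    by (simp add: det_rows_mul row_det_def mconst_det)
  finally show ?thesis .
qed

text \<open>The exponent vector of the product of all \<open>a_(r p) x_(s p)\<close>; it depends
  only on how often \<open>r\<close> and \<open>s\<close> take each value.\<close>

definition monomial :: "(3 \<Rightarrow> 3) \<Rightarrow> (3 \<Rightarrow> 3) \<Rightarrow> (3 + 3 \<Rightarrow>\<^sub>0 nat)" where
  "monomial r s = (\<Sum>p\<in>UNIV. Poly_Mapping.single (Inl (r p)) 1 + Poly_Mapping.single (Inr (s p)) 1)"

abbreviation generic_form :: "(3 \<Rightarrow> 3 \<Rightarrow> 3 \<Rightarrow> 3 \<Rightarrow> 'a::comm_ring_1) \<Rightarrow> (3 + 3, 'a) mpoly" where
  "generic_form E \<equiv> det (contracted_matrix (\<lambda>r. mvar (Inl r)) (\<lambda>s. mvar (Inr s)) E)"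

lemma prod_mvar:
  "(\<Prod>p\<in>UNIV. mvar (Inl (r p)) * mvar (Inr (s p))) = Poly_Mapping.single (monomial r s) 1"
  by (simp add: mvar_def mult_single prod_single_one monomial_def)

lemma generic_form_eq:
  "generic_form E = (\<Sum>r\<in>UNIV. \<Sum>s\<in>UNIV. Poly_Mapping.single (monomial r s) (row_det E r s))"
  by (simp add: det_contracted_matrix prod_mvar) (simp add: mconst_def mult_single)

lemma lookup_generic_form:
  "Poly_Mapping.lookup (generic_form E) m =
    (\<Sum>r\<in>UNIV. \<Sum>s\<in>UNIV. if monomial r s = m then row_det E r s else 0)"
  by (simp add: generic_form_eq lookup_sum lookup_single when_def)

text \<open>These are exactly the monomials of bidegree (3,3), so they contain the support of every
  form.\<close>

definition monomials :: "(3 + 3 \<Rightarrow>\<^sub>0 nat) set" where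
  "monomials = range (\<lambda>(r, s). monomial r s)"

lemma finite_monomials: "finite monomials"
  by (simp add: monomials_def)

lemma monomial_in_monomials: "monomial r s \<in> monomials"
  using rangeI[of "\<lambda>(r, s). monomial r s" "(r, s)"] by (simp add: monomials_def)

lemma lookup_generic_form_eq_0: "m \<notin> monomials \<Longrightarrow> Poly_Mapping.lookup (generic_form E) m = 0"
  unfolding lookup_generic_form using monomial_in_monomials by (auto intro!: sum.neutral)

lemma lookup_monomial:
  "Poly_Mapping.lookup (monomial r s) (Inl t) = card {p. r p = t}"
  "Poly_Mapping.lookup (monomial r s) (Inr t) = card {p. s p = t}"
  by (simp_all add: monomial_def lookup_sum lookup_add lookup_single when_def sum.If_cases)

text \<open>Substituting \<alpha> and \<beta> for the variables in the generic form. Written by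
  coefficients, it exhibits a substituted form as a combination of the original coefficients, which
  is what invariance under the group requires.\<close>

lemma det_contracted_matrix_monomials:
  "det (contracted_matrix \<alpha> \<beta> E) = (\<Sum>m\<in>monomials.
    (\<Prod>t\<in>UNIV. \<alpha> t ^ Poly_Mapping.lookup m (Inl t) * \<beta> t ^ Poly_Mapping.lookup m (Inr t))
      * mconst (Poly_Mapping.lookup (generic_form E) m))"
proof -
  define \<Phi> where "\<Phi> m = (\<Prod>t\<in>UNIV. \<alpha> t ^ Poly_Mapping.lookup m (Inl t) * \<beta> t ^ Poly_Mapping.lookup m (Inr t))" for m
  \<comment> \<open>Rows with the same value of \<open>r\<close> are collected into a power.\<close>
  have fibre: "(\<Prod>p\<in>UNIV. f (r p)) = (\<Prod>t\<in>UNIV. f t ^ card {p. r p = t})"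
    for f :: "3 \<Rightarrow> 'c::comm_monoid_mult" and r :: "3 \<Rightarrow> 3"
  proof -
    have "(\<Prod>p\<in>UNIV. f (r p)) = (\<Prod>t\<in>UNIV. \<Prod>p\<in>{p\<in>UNIV. r p = t}. f (r p))"
      by (rule prod.group[symmetric]) auto
    also have "\<dots> = (\<Prod>t\<in>UNIV. f t ^ card {p. r p = t})"
      by (rule prod.cong) simp_all
    finally show ?thesis .
  qed
  have *: "(\<Prod>p\<in>UNIV. \<alpha> (r p) * \<beta> (s p)) = \<Phi> (monomial r s)" for r s
    using fibre[of \<alpha> r] fibre[of \<beta> s] by (simp add: \<Phi>_def lookup_monomial prod.distrib)
  have "(\<Sum>m\<in>monomials. \<Phi> m * mconst (Poly_Mapping.lookup (generic_form E) m))
      = (\<Sum>m\<in>monomials. \<Sum>r\<in>UNIV. \<Sum>s\<in>UNIV. if monomial r s = m then \<Phi> m * mconst (row_det E r s) else 0)"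
    unfolding lookup_generic_form mconst_sum sum_distrib_left
    by (intro sum.cong refl) simp
  also have "\<dots> = (\<Sum>r\<in>UNIV. \<Sum>m\<in>monomials. \<Sum>s\<in>UNIV. if monomial r s = m then \<Phi> m * mconst (row_det E r s) else 0)"
    by (rule sum.swap)
  also have "\<dots> = (\<Sum>r\<in>UNIV. \<Sum>s\<in>UNIV. \<Sum>m\<in>monomials. if monomial r s = m then \<Phi> m * mconst (row_det E r s) else 0)"
    by (intro sum.cong refl sum.swap)
  also have "\<dots> = (\<Sum>r\<in>UNIV. \<Sum>s\<in>UNIV. \<Phi> (monomial r s) * mconst (row_det E r s))"
    by (intro sum.cong refl) (auto simp: finite_monomials monomials_def)
  finally show ?thesis
    by (simp add: det_contracted_matrix * \<Phi>_def)
qed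

abbreviation indices :: "4 \<Rightarrow> 4 \<Rightarrow> 4 \<Rightarrow> 4 \<Rightarrow> 3 \<Rightarrow> 3 \<Rightarrow> 3 \<Rightarrow> 3 \<Rightarrow> multi_index" where
  "indices i j k l p q r s \<equiv> (\<lambda>_. 0)(i := p, j := q, k := r, l := s)"

abbreviation tensor_form :: "tensor \<Rightarrow> 4 \<Rightarrow> 4 \<Rightarrow> 4 \<Rightarrow> 4 \<Rightarrow> (3 + 3, complex) mpoly" where
  "tensor_form T i j k l \<equiv> generic_form (\<lambda>p q r s. T (indices i j k l p q r s))"

lemma det_form_eq:
  "det_form i j k l = generic_form (\<lambda>p q r s. mvar (indices i j k l p q r s))"
  by (simp add: det_form_def contracted_matrix_def)

text \<open>Evaluation replaces the generic entries by those of \<open>T\<close> and commutes with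
  extracting a coefficient. Questions about the cubics thus become questions about a single form
  over the complex numbers.\<close>

lemma meval_coeff_det_form:
  "meval (Poly_Mapping.lookup (det_form i j k l) m) T = Poly_Mapping.lookup (tensor_form T i j k l) m"
  unfolding det_form_eq lookup_generic_form meval_sum
  by (intro sum.cong refl) (simp add: row_det_def meval_det)

subsection \<open>Vanishing on quadrifocal tensors\<close>

lemma UNIV_4_distinct:
  assumes "distinct [i, j, k, l :: 4]"
  shows "UNIV = {i, j, k, l}"
proof -
  have "card {i, j, k, l} = CARD(4)"
    using assms by simp
  then show ?thesis
    by (intro card_subset_eq[symmetric]) simp_all
qed

lemma prod_4_distinct:
  assumes "distinct [i, j, k, l :: 4]"
  shows "(\<Prod>c\<in>UNIV. F c) = F i * F j * F k * F l"
  unfolding UNIV_4_distinct[OF assms] using assms by (simp add: mult.assoc)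

text \<open>Laplace expansion along the first two rows: the last two rows enter only through their
  2x2 minors.\<close>

lemma det_4:
  "det (A :: 'a::comm_ring_1^4^4) =
    (A$1$1 * A$2$2 - A$1$2 * A$2$1) * (A$3$3 * A$4$4 - A$3$4 * A$4$3)
  - (A$1$1 * A$2$3 - A$1$3 * A$2$1) * (A$3$2 * A$4$4 - A$3$4 * A$4$2)
  + (A$1$1 * A$2$4 - A$1$4 * A$2$1) * (A$3$2 * A$4$3 - A$3$3 * A$4$2)
  + (A$1$2 * A$2$3 - A$1$3 * A$2$2) * (A$3$1 * A$4$4 - A$3$4 * A$4$1)
  - (A$1$2 * A$2$4 - A$1$4 * A$2$2) * (A$3$1 * A$4$3 - A$3$3 * A$4$1)
  + (A$1$3 * A$2$4 - A$1$4 * A$2$3) * (A$3$1 * A$4$2 - A$3$2 * A$4$1)"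
proof -
  have f1234: "finite {2::4, 3, 4}" "1 \<notin> {2::4, 3, 4}"
    by auto
  have f234: "finite {3::4, 4}" "2 \<notin> {3::4, 4}"
    by auto
  have f34: "finite {4::4}" "3 \<notin> {4::4}"
    by auto
  show ?thesis
    unfolding det_def UNIV_4
    unfolding sum_over_permutations_insert[OF f1234]
    unfolding sum_over_permutations_insert[OF f234]
    unfolding sum_over_permutations_insert[OF f34]
    unfolding permutes_sing
    by (simp add: sign_swap_id permutation_swap_id permutation_compose sign_compose sign_id swap_id_eq algebra_simps)
qed

text \<open>The form \<omega> depends on \<open>u\<close> and \<open>v\<close> only through the
  coordinates of their wedge product, and the Pfaffian of these vanishes. Any commutative ring is
  allowed since the entries will be polynomials in \<open>a\<close> and \<open>x\<close>.\<close>

lemma pluecker_relation: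
  fixes u v :: "'a::comm_ring_1^4"
  defines "\<omega> \<equiv> \<lambda>y z. det (\<chi> c::4. if c = 1 then y else if c = 2 then z else if c = 3 then u else v)"
  shows "\<omega> y1 y2 * \<omega> z1 z2 = \<omega> y1 z1 * \<omega> y2 z2 - \<omega> y1 z2 * \<omega> y2 z1"
proof -
  define m where "m a b = u $ a * v $ b - u $ b * v $ a" for a b
  have m: "m 1 2 * m 3 4 - m 1 3 * m 2 4 + m 1 4 * m 2 3 = 0"
    by (simp add: m_def algebra_simps)
  have \<omega>: "\<omega> y z =
      (y$1 * z$2 - y$2 * z$1) * m 3 4 - (y$1 * z$3 - y$3 * z$1) * m 2 4
    + (y$1 * z$4 - y$4 * z$1) * m 2 3 + (y$2 * z$3 - y$3 * z$2) * m 1 4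
    - (y$2 * z$4 - y$4 * z$2) * m 1 3 + (y$3 * z$4 - y$4 * z$3) * m 1 2" for y z
    by (simp add: \<omega>_def det_4 m_def)
  \<comment> \<open>With \<open>f = \<omega>(y1, \<cdot>)\<close>, the claim is the vanishing of the 3-form \<open>f \<and> \<omega>\<close>; each of its four
    coordinates is a coordinate of \<open>y1\<close> times the Pfaffian \<open>m\<close>.\<close>
  define f1 where "f1 = - y1$2 * m 3 4 + y1$3 * m 2 4 - y1$4 * m 2 3"
  define f2 where "f2 = y1$1 * m 3 4 - y1$3 * m 1 4 + y1$4 * m 1 3"
  define f3 where "f3 = - y1$1 * m 2 4 + y1$2 * m 1 4 - y1$4 * m 1 2"
  define f4 where "f4 = y1$1 * m 2 3 - y1$2 * m 1 3 + y1$3 * m 1 2"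
  have f: "\<omega> y1 z = f1 * z$1 + f2 * z$2 + f3 * z$3 + f4 * z$4" for z
    by (simp add: \<omega> f1_def f2_def f3_def f4_def algebra_simps)
  have "f1 * m 1 4 + f2 * m 2 4 + f3 * m 3 4 = - (y1$4 * (m 1 2 * m 3 4 - m 1 3 * m 2 4 + m 1 4 * m 2 3))"
    by (simp add: f1_def f2_def f3_def f4_def algebra_simps)
  then have c123: "f1 * m 1 4 + f2 * m 2 4 + f3 * m 3 4 = 0"
    by (simp only: m) simp
  have "- f1 * m 1 3 - f2 * m 2 3 + f4 * m 3 4 = (y1$3 * (m 1 2 * m 3 4 - m 1 3 * m 2 4 + m 1 4 * m 2 3))"
    by (simp add: f1_def f2_def f3_def f4_def algebra_simps)
  then have c124: "- f1 * m 1 3 - f2 * m 2 3 + f4 * m 3 4 = 0"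
    by (simp only: m) simp
  have "f1 * m 1 2 - f3 * m 2 3 - f4 * m 2 4 = - (y1$2 * (m 1 2 * m 3 4 - m 1 3 * m 2 4 + m 1 4 * m 2 3))"
    by (simp add: f1_def f2_def f3_def f4_def algebra_simps)
  then have c134: "f1 * m 1 2 - f3 * m 2 3 - f4 * m 2 4 = 0"
    by (simp only: m) simp
  have "f2 * m 1 2 + f3 * m 1 3 + f4 * m 1 4 = (y1$1 * (m 1 2 * m 3 4 - m 1 3 * m 2 4 + m 1 4 * m 2 3))"
    by (simp add: f1_def f2_def f3_def f4_def algebra_simps)
  then have c234: "f2 * m 1 2 + f3 * m 1 3 + f4 * m 1 4 = 0"
    by (simp only: m) simp
  \<comment> \<open>The left side is the 3-form at \<open>y2\<close>, \<open>z1\<close>,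
    \<open>z2\<close>; the right side pairs its four coordinates with the 3x3 minors of these
    vectors.\<close>
  have "\<omega> y1 y2 * \<omega> z1 z2 - \<omega> y1 z1 * \<omega> y2 z2 + \<omega> y1 z2 * \<omega> y2 z1 =
    (f1 * m 1 4 + f2 * m 2 4 + f3 * m 3 4) *
      (y2$1 * (z1$2 * z2$3 - z1$3 * z2$2) - y2$2 * (z1$1 * z2$3 - z1$3 * z2$1) + y2$3 * (z1$1 * z2$2 - z1$2 * z2$1))
  + (- f1 * m 1 3 - f2 * m 2 3 + f4 * m 3 4) *
      (y2$1 * (z1$2 * z2$4 - z1$4 * z2$2) - y2$2 * (z1$1 * z2$4 - z1$4 * z2$1) + y2$4 * (z1$1 * z2$2 - z1$2 * z2$1))
  + (f1 * m 1 2 - f3 * m 2 3 - f4 * m 2 4) *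
      (y2$1 * (z1$3 * z2$4 - z1$4 * z2$3) - y2$3 * (z1$1 * z2$4 - z1$4 * z2$1) + y2$4 * (z1$1 * z2$3 - z1$3 * z2$1))
  + (f2 * m 1 2 + f3 * m 1 3 + f4 * m 1 4) *
      (y2$2 * (z1$3 * z2$4 - z1$4 * z2$3) - y2$3 * (z1$2 * z2$4 - z1$4 * z2$2) + y2$4 * (z1$2 * z2$3 - z1$3 * z2$2))"
    unfolding f unfolding \<omega> by (simp add: algebra_simps)
  then have "\<omega> y1 y2 * \<omega> z1 z2 - \<omega> y1 z1 * \<omega> y2 z2 + \<omega> y1 z2 * \<omega> y2 z1 = 0"
    by (simp only: c123 c124 c134 c234) simp
  then show ?thesis
    by (simp add: algebra_simps)
qed

text \<open>By the relation, each 2x2 minor of the first two rows is \<omega>(y1, y2) times a value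
  of \<omega> on two of the \<open>z\<close>. In the expansion along the third row this factor comes
  out, and what remains is the relation once more.\<close>

lemma det_3_eq_0_if_pluecker:
  fixes \<omega> :: "'b \<Rightarrow> 'b \<Rightarrow> 'a::comm_ring_1" and y z :: "3 \<Rightarrow> 'b"
  assumes pl: "\<And>y1 y2 z1 z2. \<omega> y1 y2 * \<omega> z1 z2 = \<omega> y1 z1 * \<omega> y2 z2 - \<omega> y1 z2 * \<omega> y2 z1"
  shows "det (\<chi> p q. \<omega> (y p) (z q)) = 0"
proof -
  have "det (\<chi> p q. \<omega> (y p) (z q)) =
      \<omega> (y 3) (z 1) * (\<omega> (y 1) (z 2) * \<omega> (y 2) (z 3) - \<omega> (y 1) (z 3) * \<omega> (y 2) (z 2))
    - \<omega> (y 3) (z 2) * (\<omega> (y 1) (z 1) * \<omega> (y 2) (z 3) - \<omega> (y 1) (z 3) * \<omega> (y 2) (z 1))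
    + \<omega> (y 3) (z 3) * (\<omega> (y 1) (z 1) * \<omega> (y 2) (z 2) - \<omega> (y 1) (z 2) * \<omega> (y 2) (z 1))"
    by (simp add: det_3 algebra_simps)
  also have "\<dots> = \<omega> (y 1) (y 2) *
      (\<omega> (y 3) (z 1) * \<omega> (z 2) (z 3) - \<omega> (y 3) (z 2) * \<omega> (z 1) (z 3) + \<omega> (y 3) (z 3) * \<omega> (z 1) (z 2))"
    by (simp only: pl[symmetric]) (simp add: algebra_simps)
  also have "\<dots> = 0"
    using pl[of "y 3" "z 1" "z 2" "z 3"] by simp
  finally show ?thesis .
qed

text \<open>Placing the vectors in rows \<open>i\<close>, \<open>j\<close>, \<open>k\<close>,
  \<open>l\<close> changes \<omega> only by the sign of a permutation, and both sides of the
  relation are quadratic in \<omega>.\<close>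

lemma det_pluecker:
  fixes u v :: "'a::comm_ring_1^4"
  assumes d: "distinct [i, j, k, l]"
  defines "\<omega> \<equiv> \<lambda>y z. det (\<chi> c. ((\<lambda>_. 0)(i := y, j := z, k := u, l := v)) c)"
  shows "\<omega> y1 y2 * \<omega> z1 z2 = \<omega> y1 z1 * \<omega> y2 z2 - \<omega> y1 z2 * \<omega> y2 z1"
proof -
  define \<pi> :: "4 \<Rightarrow> 4" where "\<pi> = (\<lambda>c. if c = 1 then i else if c = 2 then j else if c = 3 then k else l)"
  have ran: "range \<pi> = UNIV"
  proof -
    have "range \<pi> = {\<pi> 1, \<pi> 2, \<pi> 3, \<pi> 4}"
      by (simp only: UNIV_4 image_insert image_empty)
    then show ?thesis
      unfolding UNIV_4_distinct[OF d] by (simp add: \<pi>_def)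
  qed
  then have \<pi>: "\<pi> permutes UNIV"
    by (intro bij_imp_permutes) (simp_all add: finite_UNIV_surj_inj bij_def)
  define \<epsilon> :: 'a where "\<epsilon> = of_int (sign \<pi>)"
  have "\<omega> y z = \<epsilon> * det (\<chi> c. if c = 1 then y else if c = 2 then z else if c = 3 then u else v)" for y z
  proof -
    let ?A = "(\<chi> c. ((\<lambda>_. 0)(i := y, j := z, k := u, l := v)) c) :: 'a^4^4"
    have "(\<chi> c. if c = 1 then y else if c = 2 then z else if c = 3 then u else v) = (\<chi> c. ?A $ \<pi> c)"
      using d by (simp add: vec_eq_iff forall_4 \<pi>_def)
    then have "det (\<chi> c. if c = 1 then y else if c = 2 then z else if c = 3 then u else v) = \<epsilon> * \<omega> y z"
      by (simp only: det_permute_rows[OF \<pi>] \<omega>_def \<epsilon>_def)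
    moreover have "\<epsilon> * \<epsilon> = 1"
      by (simp add: \<epsilon>_def sign_idempotent flip: of_int_mult)
    ultimately show ?thesis
      by (simp flip: mult.assoc)
  qed
  moreover have "\<epsilon> * a * (\<epsilon> * b) = \<epsilon> * \<epsilon> * (a * b)" for a b
    by (simp only: mult_ac)
  ultimately show ?thesis
    by (simp only: pluecker_relation[of y1 y2 u v z1 z2] right_diff_distrib)
qed

lemma tensor_form_quadrifocal:
  assumes d: "distinct [i, j, k, l]"
  shows "tensor_form (quadrifocal_of A) i j k l = 0"
proof -
  let ?a = "\<lambda>r. mvar (Inl r) :: (3 + 3, complex) mpoly"
  let ?x = "\<lambda>s. mvar (Inr s) :: (3 + 3, complex) mpoly"
  define Y where "Y c p = ((\<chi> m. mconst (A c $ p $ m)) :: (3 + 3, complex) mpoly^4)" for c p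
  \<comment> \<open>Contraction with \<open>a\<close> and \<open>x\<close> is moved inside the
    determinant: \<open>u\<close> and \<open>v\<close> are generic combinations of the rows of
    cameras \<open>k\<close> and \<open>l\<close>, the same for all entries of the 3x3
    matrix.\<close>
  define u where "u = (\<chi> m. \<Sum>r\<in>UNIV. ?a r * mconst (A k $ r $ m))"
  define v where "v = (\<chi> m. \<Sum>s\<in>UNIV. ?x s * mconst (A l $ s $ m))"
  define \<omega> where "\<omega> y z = det (\<chi> c. ((\<lambda>_. 0)(i := y, j := z, k := u, l := v)) c)" for y z
  have ne: "i \<noteq> j" "i \<noteq> k" "i \<noteq> l" "j \<noteq> k" "j \<noteq> l" "k \<noteq> l"
    using d by auto
  \<comment> \<open>With the four camera factors separated, the sums over \<open>r\<close> and
    \<open>s\<close> can be absorbed into the factors of \<open>k\<close> and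
    \<open>l\<close>.\<close>
  have Q: "quadrifocal_of A I = (\<Sum>\<sigma> | \<sigma> permutes UNIV. of_int (sign \<sigma>) *
      (A i $ I i $ \<sigma> i * A j $ I j $ \<sigma> j * A k $ I k $ \<sigma> k * A l $ I l $ \<sigma> l))" for I
  proof -
    have "quadrifocal_of A I = det (transpose (\<chi> c m. A c $ I c $ m))"
      by (simp add: quadrifocal_of_def block_matrix_def transpose_def)
    then show ?thesis
      by (simp add: det_transpose) (simp add: det_def prod_4_distinct[OF d])
  qed
  have "contracted_matrix ?a ?x (\<lambda>p q r s. quadrifocal_of A (indices i j k l p q r s))
      = (\<chi> p q. \<omega> (Y i p) (Y j q))"
  proof -
    have "(\<Sum>r\<in>UNIV. \<Sum>s\<in>UNIV. ?a r * ?x s * mconst (quadrifocal_of A (indices i j k l p q r s)))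
        = \<omega> (Y i p) (Y j q)" for p q
    proof -
      let ?t = "\<lambda>\<sigma> r s. of_int (sign \<sigma>) * (mconst (A i $ p $ \<sigma> i) * mconst (A j $ q $ \<sigma> j)
          * (?a r * mconst (A k $ r $ \<sigma> k)) * (?x s * mconst (A l $ s $ \<sigma> l)))"
      have of_int: "mconst (of_int n) = of_int n" for n
        by (simp add: mconst_def)
      have "(\<Sum>r\<in>UNIV. \<Sum>s\<in>UNIV. ?a r * ?x s * mconst (quadrifocal_of A (indices i j k l p q r s)))
          = (\<Sum>r\<in>UNIV. \<Sum>s\<in>UNIV. \<Sum>\<sigma> | \<sigma> permutes UNIV. ?t \<sigma> r s)"
        using ne by (simp add: Q mconst_sum mconst_mult sum_distrib_left of_int mult_ac)
      also have "\<dots> = (\<Sum>r\<in>UNIV. \<Sum>\<sigma> | \<sigma> permutes UNIV. \<Sum>s\<in>UNIV. ?t \<sigma> r s)"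
        by (intro sum.cong refl sum.swap)
      also have "\<dots> = (\<Sum>\<sigma> | \<sigma> permutes UNIV. \<Sum>r\<in>UNIV. \<Sum>s\<in>UNIV. ?t \<sigma> r s)"
        by (rule sum.swap)
      also have "\<dots> = \<omega> (Y i p) (Y j q)"
        using ne by (simp add: \<omega>_def det_def prod_4_distinct[OF d] Y_def u_def v_def
            flip: sum_distrib_left sum_distrib_right)
      finally show ?thesis .
    qed
    then show ?thesis
      by (simp add: contracted_matrix_def vec_eq_iff)
  qed
  moreover have "det (\<chi> p q. \<omega> (Y i p) (Y j q)) = 0"
    unfolding \<omega>_def by (intro det_3_eq_0_if_pluecker det_pluecker[OF d])
  ultimately show ?thesis
    by simp
qed

subsection \<open>The module of cubic forms\<close>

lemma cubic_forms_subspace: "tpoly.subspace cubic_forms"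
proof (rule tpoly.subspaceI)
  show "f + g \<in> cubic_forms" if "f \<in> cubic_forms" "g \<in> cubic_forms" for f g
    using that keys_add[of f g] by (auto simp: cubic_forms_def)
  show "mconst c * f \<in> cubic_forms" if "f \<in> cubic_forms" for c f
    using that by (auto simp: cubic_forms_def in_keys_iff)
qed (simp add: cubic_forms_def)

text \<open>Every term of the determinant is a signed product of three tensor entries, one from each
  row.\<close>

lemma coeff_det_form_cubic: "Poly_Mapping.lookup (det_form i j k l) m \<in> cubic_forms"
proof -
  have mvars: "(\<Prod>p\<in>UNIV. mvar (f p)) \<in> cubic_forms" for f :: "3 \<Rightarrow> multi_index"
  proof -
    have "(\<Prod>p\<in>UNIV. mvar (f p) :: tensor_poly)
        = Poly_Mapping.single (\<Sum>p\<in>UNIV. Poly_Mapping.single (f p) 1) 1"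
      by (simp add: mvar_def prod_single_one)
    moreover have "(\<Sum>I\<in>UNIV. Poly_Mapping.lookup (\<Sum>p\<in>UNIV. Poly_Mapping.single (f p) (1::nat)) I) = 3"
      unfolding lookup_sum by (subst sum.swap) (simp add: lookup_single when_def)
    ultimately show ?thesis
      by (simp add: cubic_forms_def)
  qed
  have "row_det (\<lambda>p q r s. mvar (indices i j k l p q r s)) r s \<in> cubic_forms" for r s
  proof -
    have "of_int (sign \<sigma>) * (\<Prod>p\<in>UNIV. mvar (f p)) \<in> cubic_forms" for \<sigma> :: "3 \<Rightarrow> 3" and f :: "3 \<Rightarrow> multi_index"
      using tpoly.subspace_scale[OF cubic_forms_subspace mvars, of "of_int (sign \<sigma>)"]
      by (simp add: mconst_def)
    then show ?thesis
      unfolding row_det_def det_def by (auto intro!: tpoly.subspace_sum[OF cubic_forms_subspace])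
  qed
  then show ?thesis
    unfolding det_form_eq lookup_generic_form
    by (intro tpoly.subspace_sum[OF cubic_forms_subspace])
      (auto simp: tpoly.subspace_0[OF cubic_forms_subspace])
qed

text \<open>A spanning set of the whole module at once, on which linear properties can be
  checked.\<close>

definition det_coeffs :: "tensor_poly set" where
  "det_coeffs = {Poly_Mapping.lookup (det_form i j k l) m | i j k l m. distinct [i, j, k, l]}"

lemma det_coeffsI: "distinct [i, j, k, l] \<Longrightarrow> Poly_Mapping.lookup (det_form i j k l) m \<in> det_coeffs"
  unfolding det_coeffs_def by blast

lemma S3_S3_S111_S111_eq: "S3_S3_S111_S111 = tpoly.span det_coeffs"
proof (rule antisym)
  show "S3_S3_S111_S111 \<subseteq> tpoly.span det_coeffs"
    unfolding S3_S3_S111_S111_def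
  proof (rule tpoly.span_minimal)
    have "summand i j k l \<subseteq> tpoly.span det_coeffs" if "distinct [i, j, k, l]" for i j k l
      unfolding summand_def by (rule tpoly.span_mono) (use det_coeffsI[OF that] in auto)
    then show "\<Union> {summand i j k l | i j k l. distinct [i, j, k, l]} \<subseteq> tpoly.span det_coeffs"
      by blast
  qed simp
  show "tpoly.span det_coeffs \<subseteq> S3_S3_S111_S111"
    unfolding S3_S3_S111_S111_def
  proof (rule tpoly.span_mono, rule subsetI)
    fix f assume "f \<in> det_coeffs"
    then obtain i j k l m where "f = Poly_Mapping.lookup (det_form i j k l) m" "distinct [i, j, k, l]"
      by (auto simp: det_coeffs_def)
    moreover from this have "f \<in> summand i j k l"
      by (simp add: summand_def tpoly.span_base)
    ultimately show "f \<in> \<Union> {summand i j k l | i j k l. distinct [i, j, k, l]}"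
      by blast
  qed
qed

lemma S3_S3_S111_S111_cubic: "S3_S3_S111_S111 \<subseteq> cubic_forms"
  unfolding S3_S3_S111_S111_eq
  by (rule tpoly.span_minimal) (auto simp: det_coeffs_def coeff_det_form_cubic cubic_forms_subspace)

lemma S3_S3_S111_S111_quadrifocal:
  assumes "quadrifocal Q" and "f \<in> S3_S3_S111_S111"
  shows "meval f Q = 0"
proof -
  have "tpoly.subspace {f. meval f Q = 0}"
    by (rule tpoly.subspaceI) (simp_all add: meval_add meval_mult)
  moreover have "det_coeffs \<subseteq> {f. meval f Q = 0}"
    using assms(1) by (auto simp: det_coeffs_def quadrifocal_def meval_coeff_det_form tensor_form_quadrifocal)
  ultimately show ?thesis
    using assms(2) tpoly.span_minimal unfolding S3_S3_S111_S111_eq by blast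
qed

section \<open>The group action on the determinantal forms\<close>

lemma sum_multi_index:
  assumes d: "distinct [i, j, k, l]"
  shows "(\<Sum>I\<in>UNIV. F I) = (\<Sum>p\<in>UNIV. \<Sum>q\<in>UNIV. \<Sum>r\<in>UNIV. \<Sum>s\<in>UNIV. F (indices i j k l p q r s))"
proof -
  have "(\<Sum>I\<in>UNIV. F I) = (\<Sum>(p, q, r, s)\<in>UNIV. F (indices i j k l p q r s))"
  proof (rule sum.reindex_bij_witness[where j = "\<lambda>I. (I i, I j, I k, I l)"
        and i = "\<lambda>(p, q, r, s). indices i j k l p q r s"])
    fix I :: multi_index
    have "c = i \<or> c = j \<or> c = k \<or> c = l" for c
      using UNIV_4_distinct[OF d] by blast
    then show "(case (I i, I j, I k, I l) of (p, q, r, s) \<Rightarrow> indices i j k l p q r s) = I"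
      by (auto simp: fun_eq_iff)
    then show "(case (I i, I j, I k, I l) of (p, q, r, s) \<Rightarrow> F (indices i j k l p q r s)) = F I"
      by simp
  qed (use d in auto)
  then show ?thesis
    by (simp add: sum.cartesian_product flip: UNIV_Times_UNIV)
qed

lemma indices_comp:
  assumes "\<pi> permutes UNIV"
  shows "indices i j k l p q r s \<circ> \<pi> = indices (inv \<pi> i) (inv \<pi> j) (inv \<pi> k) (inv \<pi> l) p q r s"
  by (auto simp: fun_eq_iff permutes_inverses[OF assms])

text \<open>The matrices of factors \<open>i\<close> and \<open>j\<close> multiply the contracted
  matrix from the left and the right and contribute their determinants; those of \<open>k\<close>
  and \<open>l\<close> act on the variables. Precomposing multi-indices with \<pi> moves each factor
  to its preimage, whence \<open>inv \<pi>\<close>.\<close>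

lemma tensor_form_tensor_act:
  fixes g :: "4 \<Rightarrow> complex^3^3"
  assumes d: "distinct [i, j, k, l]" and \<pi>: "\<pi> permutes UNIV"
  defines "\<alpha> \<equiv> \<lambda>r'. \<Sum>r\<in>UNIV. mvar (Inl r) * mconst (g k $ r $ r')"
    and "\<beta> \<equiv> \<lambda>s'. \<Sum>s\<in>UNIV. mvar (Inr s) * mconst (g l $ s $ s')"
  shows "tensor_form (tensor_act \<pi> g T) i j k l = mconst (det (g i) * det (g j)) *
    det (contracted_matrix \<alpha> \<beta>
      (\<lambda>p q r s. T (indices (inv \<pi> i) (inv \<pi> j) (inv \<pi> k) (inv \<pi> l) p q r s)))"
proof -
  let ?T = "\<lambda>p q r s. T (indices (inv \<pi> i) (inv \<pi> j) (inv \<pi> k) (inv \<pi> l) p q r s)"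
  let ?N = "contracted_matrix \<alpha> \<beta> ?T"
  let ?G = "\<lambda>c. (\<chi> p p'. mconst (g c $ p $ p')) :: (3 + 3, complex) mpoly^3^3"
  have ne: "i \<noteq> j" "i \<noteq> k" "i \<noteq> l" "j \<noteq> k" "j \<noteq> l" "k \<noteq> l"
    using d by auto
  have act: "tensor_act \<pi> g T (indices i j k l p q r s) = (\<Sum>p'\<in>UNIV. \<Sum>q'\<in>UNIV. \<Sum>r'\<in>UNIV. \<Sum>s'\<in>UNIV.
      g i $ p $ p' * g j $ q $ q' * g k $ r $ r' * g l $ s $ s' * ?T p' q' r' s')" for p q r s
    unfolding tensor_act_def sum_multi_index[OF d] prod_4_distinct[OF d] indices_comp[OF \<pi>]
    using ne by simp
  have entry: "(\<Sum>r\<in>UNIV. \<Sum>s\<in>UNIV. mvar (Inl r) * mvar (Inr s) * mconst (tensor_act \<pi> g T (indices i j k l p q r s)))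
      = (?G i ** ?N ** transpose (?G j)) $ p $ q" for p q
  proof -
    let ?t = "\<lambda>r s p' q' r' s'. mconst (g i $ p $ p') * mconst (g j $ q $ q') *
      ((mvar (Inl r) * mconst (g k $ r $ r')) * (mvar (Inr s) * mconst (g l $ s $ s')) * mconst (?T p' q' r' s'))"
    have "(?G i ** ?N ** transpose (?G j)) $ p $ q = (\<Sum>q'\<in>UNIV. \<Sum>p'\<in>UNIV. \<Sum>r'\<in>UNIV. \<Sum>s'\<in>UNIV.
        mconst (g i $ p $ p') * mconst (g j $ q $ q') * (\<alpha> r' * \<beta> s' * mconst (?T p' q' r' s')))"
      by (simp add: matrix_matrix_mult_def contracted_matrix_def transpose_def
          sum_distrib_left sum_distrib_right mult_ac)
    also have "\<dots> = (\<Sum>p'\<in>UNIV. \<Sum>q'\<in>UNIV. \<Sum>r'\<in>UNIV. \<Sum>s'\<in>UNIV.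
        mconst (g i $ p $ p') * mconst (g j $ q $ q') * (\<alpha> r' * \<beta> s' * mconst (?T p' q' r' s')))"
      by (rule sum.swap)
    also have "\<dots> = (\<Sum>p'\<in>UNIV. \<Sum>q'\<in>UNIV. \<Sum>r'\<in>UNIV. \<Sum>s'\<in>UNIV. \<Sum>r\<in>UNIV. \<Sum>s\<in>UNIV. ?t r s p' q' r' s')"
      unfolding \<alpha>_def \<beta>_def sum_product by (simp only: sum_distrib_left sum_distrib_right)
    \<comment> \<open>Merging the six sums into one over tuples makes the reordering a single
      reindexing.\<close>
    also have "\<dots> = (\<Sum>r\<in>UNIV. \<Sum>s\<in>UNIV. \<Sum>p'\<in>UNIV. \<Sum>q'\<in>UNIV. \<Sum>r'\<in>UNIV. \<Sum>s'\<in>UNIV. ?t r s p' q' r' s')"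
      unfolding sum.cartesian_product
      by (rule sum.reindex_bij_witness[where i = "\<lambda>(r, s, p, q, r', s'). (p, q, r', s', r, s)"
            and j = "\<lambda>(p, q, r', s', r, s). (r, s, p, q, r', s')"]) auto
    also have "\<dots> = (\<Sum>r\<in>UNIV. \<Sum>s\<in>UNIV. mvar (Inl r) * mvar (Inr s) *
        mconst (tensor_act \<pi> g T (indices i j k l p q r s)))"
      by (simp add: act mconst_sum mconst_mult sum_distrib_left mult_ac)
    finally show ?thesis
      by simp
  qed
  have "contracted_matrix (\<lambda>r. mvar (Inl r)) (\<lambda>s. mvar (Inr s))
      (\<lambda>p q r s. tensor_act \<pi> g T (indices i j k l p q r s)) = ?G i ** ?N ** transpose (?G j)"
    using entry by (simp add: contracted_matrix_def[of "\<lambda>r. mvar (Inl r)"] vec_eq_iff)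
  then show ?thesis
    by (simp add: det_mul det_transpose mconst_mult mconst_det mult_ac)
qed

text \<open>The polynomials whose transform lies in the module form a subspace, so it is enough to
  transform the coefficients of the forms.\<close>

lemma G_submodule_S3_S3_S111_S111: "G_submodule S3_S3_S111_S111"
  unfolding G_submodule_def
proof (intro conjI allI impI ballI)
  show "tpoly.subspace S3_S3_S111_S111"
    by (simp add: S3_S3_S111_S111_eq)
next
  fix \<pi> :: "4 \<Rightarrow> 4" and g :: "4 \<Rightarrow> complex^3^3" and f
  assume \<pi>: "\<pi> permutes UNIV" and f: "f \<in> S3_S3_S111_S111"
  let ?W = "S3_S3_S111_S111"
  let ?P = "\<lambda>f h. \<forall>T. meval h T = meval f (tensor_act \<pi> g T)"
  have W: "tpoly.subspace ?W"
    by (simp add: S3_S3_S111_S111_eq)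
  have "tpoly.subspace {f. \<exists>h\<in>?W. ?P f h}"
  proof (rule tpoly.subspaceI)
    show "0 \<in> {f. \<exists>h\<in>?W. ?P f h}"
      using tpoly.subspace_0[OF W] by (auto intro!: bexI[of _ 0])
    show "f + f' \<in> {f. \<exists>h\<in>?W. ?P f h}" if ff: "f \<in> {f. \<exists>h\<in>?W. ?P f h}" "f' \<in> {f. \<exists>h\<in>?W. ?P f h}" for f f'
    proof -
      from ff obtain h h' where "h \<in> ?W" "?P f h" "h' \<in> ?W" "?P f' h'"
        by blast
      then show ?thesis
        by (auto simp: meval_add intro!: bexI[of _ "h + h'"] tpoly.subspace_add[OF W])
    qed
    show "mconst c * f \<in> {f. \<exists>h\<in>?W. ?P f h}" if ff: "f \<in> {f. \<exists>h\<in>?W. ?P f h}" for c f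
    proof -
      from ff obtain h where "h \<in> ?W" "?P f h"
        by blast
      then show ?thesis
        by (auto simp: meval_mult intro!: bexI[of _ "mconst c * h"] tpoly.subspace_scale[OF W])
    qed
  qed
  moreover have "det_coeffs \<subseteq> {f. \<exists>h\<in>?W. ?P f h}"
  proof
    fix f assume "f \<in> det_coeffs"
    then obtain i j k l n where f: "f = Poly_Mapping.lookup (det_form i j k l) n" and d: "distinct [i, j, k, l]"
      by (auto simp: det_coeffs_def)
    define \<alpha> :: "3 \<Rightarrow> (3 + 3, complex) mpoly" where "\<alpha> r' = (\<Sum>r\<in>UNIV. mvar (Inl r) * mconst (g k $ r $ r'))" for r'
    define \<beta> :: "3 \<Rightarrow> (3 + 3, complex) mpoly" where "\<beta> s' = (\<Sum>s\<in>UNIV. mvar (Inr s) * mconst (g l $ s $ s'))" for s'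
    let ?D = "det_form (inv \<pi> i) (inv \<pi> j) (inv \<pi> k) (inv \<pi> l)"
    \<comment> \<open>Up to the determinants, the coefficient of \<open>n\<close> in the monomial
      \<open>m\<close> after substitution. It does not involve the tensor, so \<open>?h\<close> is
      one polynomial that works for all \<open>T\<close>.\<close>
    let ?c = "\<lambda>m. det (g i) * det (g j) * Poly_Mapping.lookup
      (\<Prod>t\<in>UNIV. \<alpha> t ^ Poly_Mapping.lookup m (Inl t) * \<beta> t ^ Poly_Mapping.lookup m (Inr t)) n"
    let ?h = "\<Sum>m\<in>monomials. mconst (?c m) * Poly_Mapping.lookup ?D m"
    have "inj (inv \<pi>)"
      using permutes_inj[OF permutes_inv[OF \<pi>]] .
    then have d': "distinct [inv \<pi> i, inv \<pi> j, inv \<pi> k, inv \<pi> l]"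
      using d by (simp add: inj_eq)
    then have "Poly_Mapping.lookup ?D m \<in> ?W" for m
      unfolding S3_S3_S111_S111_eq by (intro tpoly.span_base det_coeffsI)
    then have "?h \<in> ?W"
      by (intro tpoly.subspace_sum[OF W] tpoly.subspace_scale[OF W])
    moreover have "?P f ?h"
    proof
      fix T :: tensor
      let ?T = "\<lambda>p q r s. T (indices (inv \<pi> i) (inv \<pi> j) (inv \<pi> k) (inv \<pi> l) p q r s)"
      have "tensor_form (tensor_act \<pi> g T) i j k l
          = mconst (det (g i) * det (g j)) * det (contracted_matrix \<alpha> \<beta> ?T)"
        using tensor_form_tensor_act[OF d \<pi>] unfolding \<alpha>_def \<beta>_def .
      then have "meval f (tensor_act \<pi> g T)
          = det (g i) * det (g j) * Poly_Mapping.lookup (det (contracted_matrix \<alpha> \<beta> ?T)) n"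
        by (simp only: f meval_coeff_det_form lookup_mconst_mult)
      also have "\<dots> = (\<Sum>m\<in>monomials. ?c m * Poly_Mapping.lookup (generic_form ?T) m)"
        by (subst det_contracted_matrix_monomials) (simp only: lookup_sum lookup_mult_mconst sum_distrib_left mult.assoc)
      also have "\<dots> = meval ?h T"
        by (simp only: meval_sum meval_mult meval_mconst meval_coeff_det_form)
      finally show "meval ?h T = meval f (tensor_act \<pi> g T)" ..
    qed
    ultimately show "f \<in> {f. \<exists>h\<in>?W. ?P f h}"
      by blast
  qed
  ultimately have "tpoly.span det_coeffs \<subseteq> {f. \<exists>h\<in>?W. ?P f h}"
    by (intro tpoly.span_minimal)
  then show "\<exists>h\<in>?W. ?P f h"
    using f unfolding S3_S3_S111_S111_eq by blast
qed

subsection \<open>The dimension\<close>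

lemma generic_form_transpose:
  fixes E :: "3 \<Rightarrow> 3 \<Rightarrow> 3 \<Rightarrow> 3 \<Rightarrow> 'a::comm_ring_1"
  shows "generic_form (\<lambda>p q r s. E q p r s) = generic_form E"
proof -
  have "contracted_matrix \<alpha> \<beta> (\<lambda>p q r s. E q p r s) = transpose (contracted_matrix \<alpha> \<beta> E)"
    for \<alpha> \<beta> :: "3 \<Rightarrow> (3 + 3, 'a) mpoly"
    by (simp add: contracted_matrix_def transpose_def)
  then show ?thesis
    by (simp add: det_transpose)
qed

lemma indices_commute:
  assumes "distinct [i, j, k, l]"
  shows "indices j i k l q p r s = indices i j k l p q r s"
    and "indices i j l k p q s r = indices i j k l p q r s"
  using assms by (auto simp: fun_eq_iff)

lemma det_form_swap_det:
  assumes "distinct [i, j, k, l]"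
  shows "det_form j i k l = det_form i j k l"
  using generic_form_transpose[of "\<lambda>p q r s. mvar (indices i j k l p q r s)"] assms
  by (simp add: det_form_eq indices_commute)

lemma tensor_form_swap_det:
  assumes "distinct [i, j, k, l]"
  shows "tensor_form T j i k l = tensor_form T i j k l"
  using generic_form_transpose[of "\<lambda>p q r s. T (indices i j k l p q r s)"] assms
  by (simp add: indices_commute)

lemma monomial_eq_iff:
  "monomial r s = monomial u v \<longleftrightarrow>
    (\<forall>t. card {p. r p = t} = card {p. u p = t}) \<and> (\<forall>t. card {p. s p = t} = card {p. v p = t})"
proof -
  have "m = n \<longleftrightarrow> (\<forall>t. Poly_Mapping.lookup m (Inl t) = Poly_Mapping.lookup n (Inl t)) \<and>
      (\<forall>t. Poly_Mapping.lookup m (Inr t) = Poly_Mapping.lookup n (Inr t))" for m n :: "3 + 3 \<Rightarrow>\<^sub>0 nat"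
    unfolding poly_mapping_eq_iff fun_eq_iff by (metis sum.exhaust)
  then show ?thesis
    by (simp add: lookup_monomial)
qed

text \<open>Exchanging \<open>k\<close> and \<open>l\<close> exchanges the variables
  \<open>a\<close> and \<open>x\<close>: the coefficients are the same up to renaming the monomial.
  Outside bidegree (3,3) both forms have coefficient zero.\<close>

lemma coeff_det_form_swap_sym:
  assumes d: "distinct [i, j, k, l]"
  shows "\<exists>n. Poly_Mapping.lookup (det_form i j l k) m = Poly_Mapping.lookup (det_form i j k l) n"
proof (cases "m \<in> monomials")
  case True
  then obtain u v where m: "m = monomial u v"
    by (auto simp: monomials_def)
  let ?E = "\<lambda>p q r s. mvar (indices i j k l p q r s)"
  let ?E' = "\<lambda>p q r s. mvar (indices i j l k p q r s)"
  have E': "?E' = (\<lambda>p q r s. ?E p q s r)"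
    using d by (simp add: indices_commute fun_eq_iff)
  have rd: "row_det ?E' r s = row_det ?E s r" for r s
    unfolding E' by (simp add: row_det_def)
  have eq: "monomial r s = monomial u v \<longleftrightarrow> monomial s r = monomial v u" for r s
    by (auto simp: monomial_eq_iff)
  have "Poly_Mapping.lookup (det_form i j l k) m = (\<Sum>r\<in>UNIV. \<Sum>s\<in>UNIV.
      if monomial s r = monomial v u then row_det ?E s r else 0)"
    unfolding m det_form_eq lookup_generic_form rd eq ..
  also have "\<dots> = Poly_Mapping.lookup (det_form i j k l) (monomial v u)"
    unfolding det_form_eq lookup_generic_form by (rule sum.swap)
  finally show ?thesis
    by blast
next
  case False
  then show ?thesis
    by (metis det_form_eq lookup_generic_form_eq_0)
qed

text \<open>One representative for each class of four arrangements related by exchanging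
  \<open>i\<close>, \<open>j\<close> or \<open>k\<close>, \<open>l\<close>.\<close>

definition splittings :: "(4 \<times> 4 \<times> 4 \<times> 4) set" where
  "splittings = {(1, 2, 3, 4), (1, 3, 2, 4), (1, 4, 2, 3), (2, 3, 1, 4), (2, 4, 1, 3), (3, 4, 1, 2)}"

definition basis_coeff :: "(4 \<times> 4 \<times> 4 \<times> 4) \<times> (3 + 3 \<Rightarrow>\<^sub>0 nat) \<Rightarrow> tensor_poly" where
  "basis_coeff = (\<lambda>((i, j, k, l), m). Poly_Mapping.lookup (det_form i j k l) m)"

lemma splittings_distinct: "(i, j, k, l) \<in> splittings \<Longrightarrow> distinct [i, j, k, l]"
  by (auto simp: splittings_def)

lemma splittings_cases:
  assumes "distinct [i, j, k, l]"
  shows "(i, j, k, l) \<in> splittings \<or> (j, i, k, l) \<in> splittings \<or>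
    (i, j, l, k) \<in> splittings \<or> (j, i, l, k) \<in> splittings"
  using assms exhaust_4[of i] exhaust_4[of j] exhaust_4[of k] exhaust_4[of l]
  by (elim disjE) (simp_all add: splittings_def)

text \<open>The exchanges lead from any arrangement to a representative. Zero is added to cover
  monomials of other bidegrees.\<close>

lemma coeffs_in_basis:
  assumes d: "distinct [i, j, k, l]"
  shows "Poly_Mapping.lookup (det_form i j k l) m \<in> insert 0 (basis_coeff ` (splittings \<times> monomials))"
proof -
  have base: "Poly_Mapping.lookup (det_form i j k l) m \<in> insert 0 (basis_coeff ` (splittings \<times> monomials))"
    if "(i, j, k, l) \<in> splittings" for i j k l m
  proof (cases "m \<in> monomials")
    case True
    then have "basis_coeff ((i, j, k, l), m) \<in> basis_coeff ` (splittings \<times> monomials)"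
      using that by blast
    then show ?thesis
      by (simp add: basis_coeff_def)
  next
    case False
    then show ?thesis
      by (simp add: det_form_eq lookup_generic_form_eq_0)
  qed
  have d': "distinct [j, i, k, l]"
    using d by auto
  from splittings_cases[OF d] show ?thesis
  proof (elim disjE)
    show ?thesis if "(i, j, k, l) \<in> splittings"
      using base[OF that] .
    show ?thesis if "(j, i, k, l) \<in> splittings"
      using base[OF that] det_form_swap_det[OF d] by simp
    show ?thesis if "(i, j, l, k) \<in> splittings"
      using base[OF that] coeff_det_form_swap_sym[of i j l k m] d by force
    show ?thesis if "(j, i, l, k) \<in> splittings"
      using base[OF that] coeff_det_form_swap_sym[of j i l k m] det_form_swap_det[OF d] d by force
  qed
qed

lemma span_basis_coeff: "tpoly.span (basis_coeff ` (splittings \<times> monomials)) = S3_S3_S111_S111"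
proof -
  have "det_coeffs \<subseteq> insert 0 (basis_coeff ` (splittings \<times> monomials))"
    using coeffs_in_basis unfolding det_coeffs_def by blast
  then have "tpoly.span det_coeffs \<subseteq> tpoly.span (basis_coeff ` (splittings \<times> monomials))"
    by (metis tpoly.span_insert_0 tpoly.span_mono)
  moreover have "basis_coeff ` (splittings \<times> monomials) \<subseteq> det_coeffs"
    using det_coeffsI[OF splittings_distinct] by (auto simp: basis_coeff_def)
  then have "tpoly.span (basis_coeff ` (splittings \<times> monomials)) \<subseteq> tpoly.span det_coeffs"
    by (rule tpoly.span_mono)
  ultimately show ?thesis
    unfolding S3_S3_S111_S111_eq by (rule antisym[rotated])
qed

section \<open>Evaluation at diagonal tensors and dual functionals\<close>

text \<open>In the \<open>t\<close>-th term the index of the determinant factor \<open>i'\<close> is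
  forced to be \<open>u t\<close>, and the rest ignores that index. Permuting \<open>u\<close>
  therefore permutes columns of one matrix factor and costs only the sign.\<close>

lemma tensor_form_antisym:
  fixes R :: "3 \<Rightarrow> tensor"
  assumes d: "distinct [i', j', k', l']" and R: "\<And>t I p. R t (I(i' := p)) = R t I" and \<tau>: "\<tau> permutes UNIV"
  defines "T \<equiv> \<lambda>u I. \<Sum>t\<in>UNIV. if I i' = u t then R t I else 0"
  shows "tensor_form (T (u \<circ> \<tau>)) i' j' k' l' = of_int (sign \<tau>) * tensor_form (T u) i' j' k' l'"
proof -
  \<comment> \<open>The contracted matrix factors as \<open>U \<cdot> S\<close> where only \<open>U\<close> depends on \<open>u\<close>.\<close>
  let ?U = "\<lambda>u. (\<chi> p t. if p = u t then 1 else 0) :: (3 + 3, complex) mpoly^3^3"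
  let ?S = "(\<chi> t q. \<Sum>r\<in>UNIV. \<Sum>s\<in>UNIV. mvar (Inl r) * mvar (Inr s) * mconst (R t (indices i' j' k' l' 0 q r s)))
    :: (3 + 3, complex) mpoly^3^3"
  have R': "R t (indices i' j' k' l' p q r s) = R t (indices i' j' k' l' 0 q r s)" for t p q r s
  proof -
    have "indices i' j' k' l' p q r s = (indices i' j' k' l' 0 q r s)(i' := p)"
      using d by (auto simp: fun_eq_iff)
    then show ?thesis
      by (metis R)
  qed
  have "contracted_matrix (\<lambda>r. mvar (Inl r)) (\<lambda>s. mvar (Inr s)) (\<lambda>p q r s. T u (indices i' j' k' l' p q r s))
      = ?U u ** ?S" for u
  proof -
    have "(\<Sum>r\<in>UNIV. \<Sum>s\<in>UNIV. mvar (Inl r) * mvar (Inr s) * mconst (T u (indices i' j' k' l' p q r s)))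
        = (\<Sum>t\<in>UNIV. (if p = u t then 1 else 0) * (\<Sum>r\<in>UNIV. \<Sum>s\<in>UNIV. mvar (Inl r) * mvar (Inr s) *
            mconst (R t (indices i' j' k' l' 0 q r s))))" (is "?L = ?R") for p q
    proof -
      let ?t = "\<lambda>t r s. (if p = u t then 1 else 0) * (mvar (Inl r) * mvar (Inr s) *
            mconst (R t (indices i' j' k' l' 0 q r s)))"
      have "?L = (\<Sum>r\<in>UNIV. \<Sum>s\<in>UNIV. \<Sum>t\<in>UNIV. ?t t r s)"
      proof -
        have "T u (indices i' j' k' l' p q r s)
            = (\<Sum>t\<in>UNIV. if p = u t then R t (indices i' j' k' l' 0 q r s) else 0)" for r s
          unfolding T_def R'[of _ p] using d by simp
        then show ?thesis
          by (auto simp: mconst_sum sum_distrib_left intro!: sum.cong)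
      qed
      also have "\<dots> = (\<Sum>r\<in>UNIV. \<Sum>t\<in>UNIV. \<Sum>s\<in>UNIV. ?t t r s)"
        by (intro sum.cong refl sum.swap)
      also have "\<dots> = (\<Sum>t\<in>UNIV. \<Sum>r\<in>UNIV. \<Sum>s\<in>UNIV. ?t t r s)"
        by (rule sum.swap)
      finally show ?thesis
        by (simp only: sum_distrib_left)
    qed
    then show ?thesis
      by (simp add: contracted_matrix_def matrix_matrix_mult_def vec_eq_iff)
  qed
  then have "tensor_form (T u) i' j' k' l' = det (?U u) * det ?S" for u
    by (simp only: det_mul)
  moreover have "det (?U (u \<circ> \<tau>)) = of_int (sign \<tau>) * det (?U u)"
    using det_permute_columns[OF \<tau>, of "?U u"] by simp
  ultimately show ?thesis
    by (simp only: mult.assoc)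
qed

definition diagonal_tensor :: "4 \<Rightarrow> 4 \<Rightarrow> 4 \<Rightarrow> 4 \<Rightarrow> (3 \<Rightarrow> 3) \<Rightarrow> (3 \<Rightarrow> 3) \<Rightarrow> tensor" where
  "diagonal_tensor i j k l u v =
    (\<lambda>I. \<Sum>t\<in>UNIV. if I i = t \<and> I j = t \<and> I k = u t \<and> I l = v t then 1 else 0)"

text \<open>The contracted matrix is diagonal, with entries \<open>a_(u p) x_(v p)\<close>.\<close>

lemma tensor_form_diagonal_tensor:
  assumes d: "distinct [i, j, k, l]"
  shows "tensor_form (diagonal_tensor i j k l u v) i j k l = Poly_Mapping.single (monomial u v) 1"
proof -
  let ?M = "contracted_matrix (\<lambda>r. mvar (Inl r)) (\<lambda>s. mvar (Inr s))
    (\<lambda>p q r s. diagonal_tensor i j k l u v (indices i j k l p q r s))"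
  have T: "diagonal_tensor i j k l u v (indices i j k l p q r s)
      = (if s = v p then if r = u p then if p = q then 1 else 0 else 0 else 0)" for p q r s
  proof -
    have "diagonal_tensor i j k l u v (indices i j k l p q r s)
        = (\<Sum>t\<in>UNIV. if t = p then if p = q \<and> r = u p \<and> s = v p then 1 else 0 else 0)"
      unfolding diagonal_tensor_def using d by (intro sum.cong) auto
    then show ?thesis
      by simp
  qed
  have M: "?M $ p $ q = (if p = q then mvar (Inl (u p)) * mvar (Inr (v p)) else 0)" for p q
    by (simp add: contracted_matrix_def T if_distrib[of mconst] if_distrib[of "\<lambda>x. _ * x"] cong: if_cong)
  then have "det ?M = (\<Prod>p\<in>UNIV. ?M $ p $ p)"
    by (intro det_diagonal) simp
  then show ?thesis
    by (simp add: M prod_mvar)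
qed

text \<open>When \<open>k\<close> is a determinant factor of the form, the tensor has the required
  shape with respect to \<open>u\<close>; for \<open>l\<close>, with respect to \<open>v\<close>.
  The position \<open>j'\<close> reduces to \<open>i'\<close> by transposing the matrix.\<close>

lemma diagonal_tensor_antisym:
  assumes d: "distinct [i, j, k, l]" and d': "distinct [i', j', k', l']" and \<tau>: "\<tau> permutes UNIV"
  shows "i' = k \<or> j' = k \<Longrightarrow> tensor_form (diagonal_tensor i j k l (u \<circ> \<tau>) v) i' j' k' l'
      = of_int (sign \<tau>) * tensor_form (diagonal_tensor i j k l u v) i' j' k' l'" (is "_ \<Longrightarrow> ?A i' j'")
    and "i' = l \<or> j' = l \<Longrightarrow> tensor_form (diagonal_tensor i j k l u (v \<circ> \<tau>)) i' j' k' l'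
      = of_int (sign \<tau>) * tensor_form (diagonal_tensor i j k l u v) i' j' k' l'" (is "_ \<Longrightarrow> ?B i' j'")
proof -
  have Tk: "diagonal_tensor i j k l u v =
      (\<lambda>I. \<Sum>t\<in>UNIV. if I k = u t then if I i = t \<and> I j = t \<and> I l = v t then 1 else 0 else 0)" for u
    unfolding diagonal_tensor_def by (intro ext sum.cong) auto
  have Tl: "diagonal_tensor i j k l u v =
      (\<lambda>I. \<Sum>t\<in>UNIV. if I l = v t then if I i = t \<and> I j = t \<and> I k = u t then 1 else 0 else 0)" for v
    unfolding diagonal_tensor_def by (intro ext sum.cong) auto
  have A: "?A k j'" if "distinct [k, j', k', l']" for j'
    unfolding Tk by (rule tensor_form_antisym[OF that _ \<tau>]) (use d in auto)
  have B: "?B l j'" if "distinct [l, j', k', l']" for j'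
    unfolding Tl by (rule tensor_form_antisym[OF that _ \<tau>]) (use d in auto)
  have d'': "distinct [j', i', k', l']"
    using d' by auto
  note swap = tensor_form_swap_det[OF d'']
  show "?A i' j'" if "i' = k \<or> j' = k"
    using that
  proof
    assume e: "i' = k"
    show ?thesis
      using A[of j'] d' unfolding e by blast
  next
    assume e: "j' = k"
    have "?A j' i'"
      using A[of i'] d'' unfolding e by blast
    then show ?thesis
      by (simp only: swap[of "diagonal_tensor i j k l u v"] swap[of "diagonal_tensor i j k l (u \<circ> \<tau>) v"])
  qed
  show "?B i' j'" if "i' = l \<or> j' = l"
    using that
  proof
    assume e: "i' = l"
    show ?thesis
      using B[of j'] d' unfolding e by blast
  next
    assume e: "j' = l"
    have "?B j' i'"
      using B[of i'] d'' unfolding e by blast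
    then show ?thesis
      by (simp only: swap[of "diagonal_tensor i j k l u v"] swap[of "diagonal_tensor i j k l u (v \<circ> \<tau>)"])
  qed
qed

lemma monomial_permute:
  assumes "\<tau> permutes UNIV"
  shows "monomial (r \<circ> \<tau>) s = monomial r s" and "monomial r (s \<circ> \<tau>) = monomial r s"
proof -
  have "(\<Sum>p\<in>UNIV. Poly_Mapping.single (f (\<tau> p)) (1::nat)) = (\<Sum>p\<in>UNIV. Poly_Mapping.single (f p) 1)"
    for f :: "3 \<Rightarrow> 3 + 3"
    using sum.permute[OF assms, of "\<lambda>p. Poly_Mapping.single (f p) (1::nat)"] by (simp add: comp_def)
  from this[of "\<lambda>p. Inl (r p)"] this[of "\<lambda>p. Inr (s p)"]
  show "monomial (r \<circ> \<tau>) s = monomial r s" and "monomial r (s \<circ> \<tau>) = monomial r s"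
    by (simp_all add: monomial_def sum.distrib)
qed

text \<open>A different pair of determinant factors must meet the complement of the first
  pair.\<close>

lemma splittings_neq:
  assumes "(i, j, k, l) \<in> splittings" and "(i', j', k', l') \<in> splittings"
    and "(i, j, k, l) \<noteq> (i', j', k', l')"
  shows "i' = k \<or> j' = k \<or> i' = l \<or> j' = l"
  using assms by (auto simp: splittings_def)

text \<open>Symmetrisation in \<open>u\<close> and in \<open>v\<close> separately. One transposition
  in each is enough to cancel whatever alternates in \<open>u\<close> or in
  \<open>v\<close>.\<close>

definition dual_functional ::
    "4 \<Rightarrow> 4 \<Rightarrow> 4 \<Rightarrow> 4 \<Rightarrow> (3 \<Rightarrow> 3) \<Rightarrow> (3 \<Rightarrow> 3) \<Rightarrow> tensor_poly \<Rightarrow> complex" where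
  "dual_functional i j k l u v f =
    (let \<tau> = Transposition.transpose 1 2; T = diagonal_tensor i j k l in
      meval f (T u v) + meval f (T (u \<circ> \<tau>) v) + meval f (T u (v \<circ> \<tau>)) + meval f (T (u \<circ> \<tau>) (v \<circ> \<tau>)))"

text \<open>For the same splitting all four tensors give the same monomial, hence the value 4; for
  another one the evaluations cancel in pairs.\<close>

lemma dual_functional_basis_coeff:
  assumes P: "(i, j, k, l) \<in> splittings" and P': "P' \<in> splittings"
  shows "dual_functional i j k l u v (basis_coeff (P', m))
    = (if P' = (i, j, k, l) \<and> m = monomial u v then 4 else 0)"
proof -
  obtain i' j' k' l' where P'_eq: "P' = (i', j', k', l')"
    by (metis surj_pair)
  define \<tau> :: "3 \<Rightarrow> 3" where "\<tau> = Transposition.transpose 1 2"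
  have \<tau>: "\<tau> permutes UNIV" "sign \<tau> = - 1"
    by (simp_all add: \<tau>_def permutes_swap_id sign_swap_id)
  note d = splittings_distinct[OF P] and d' = splittings_distinct[OF P'[unfolded P'_eq]]
  let ?F = "\<lambda>u v. tensor_form (diagonal_tensor i j k l u v) i' j' k' l'"
  have \<phi>: "dual_functional i j k l u v (basis_coeff (P', m)) = Poly_Mapping.lookup (?F u v) m
      + Poly_Mapping.lookup (?F (u \<circ> \<tau>) v) m + Poly_Mapping.lookup (?F u (v \<circ> \<tau>)) m
      + Poly_Mapping.lookup (?F (u \<circ> \<tau>) (v \<circ> \<tau>)) m"
    unfolding dual_functional_def Let_def \<tau>_def[symmetric] basis_coeff_def P'_eq split
      meval_coeff_det_form ..
  show ?thesis
  proof (cases "P' = (i, j, k, l)")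
    case True
    then have eq: "i' = i" "j' = j" "k' = k" "l' = l"
      using P'_eq by simp_all
    show ?thesis
      using True unfolding \<phi> eq tensor_form_diagonal_tensor[OF d] monomial_permute[OF \<tau>(1)]
      by (simp add: lookup_single when_def)
  next
    case False
    \<comment> \<open>The cases may overlap; a sign change in either \<open>u\<close> or
      \<open>v\<close> suffices for the cancellation.\<close>
    then consider "i' = k \<or> j' = k" | "i' = l \<or> j' = l"
      using splittings_neq[OF P P'[unfolded P'_eq]] P'_eq by blast
    then have "dual_functional i j k l u v (basis_coeff (P', m)) = 0"
    proof cases
      case 1
      from diagonal_tensor_antisym(1)[OF d d' \<tau>(1) 1] show ?thesis
        unfolding \<phi> by (simp add: \<tau>(2))
    next
      case 2
      from diagonal_tensor_antisym(2)[OF d d' \<tau>(1) 2] show ?thesis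
        unfolding \<phi> by (simp add: \<tau>(2))
    qed
    with False show ?thesis
      by simp
  qed
qed

lemma dual_functional_linear:
  "dual_functional i j k l u v (\<Sum>b\<in>S. mconst (c b) * F b) = (\<Sum>b\<in>S. c b * dual_functional i j k l u v (F b))"
  by (simp add: dual_functional_def Let_def meval_sum meval_mult sum.distrib distrib_left)

text \<open>The functional of an index is nonzero on its own coefficient and zero at every other
  index. Injectivity makes the number of indices the size of the basis.\<close>

lemma inj_on_basis_coeff: "inj_on basis_coeff (splittings \<times> monomials)"
proof (rule inj_onI)
  fix b b' assume b: "b \<in> splittings \<times> monomials" "b' \<in> splittings \<times> monomials"
    and eq: "basis_coeff b = basis_coeff b'"
  obtain i j k l u v where b_eq: "b = ((i, j, k, l), monomial u v)"
    using b(1) by (auto simp: monomials_def)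
  obtain P' m' where b'_eq: "b' = (P', m')"
    by fastforce
  have P: "(i, j, k, l) \<in> splittings" "P' \<in> splittings"
    using b by (simp_all add: b_eq b'_eq)
  have "dual_functional i j k l u v (basis_coeff b') = 4"
    unfolding eq[symmetric] b_eq dual_functional_basis_coeff[OF P(1) P(1)] by simp
  then show "b = b'"
    unfolding b_eq b'_eq dual_functional_basis_coeff[OF P] by (auto split: if_splits)
qed

text \<open>Applying the dual functional of an index to a linear relation isolates four times its
  scalar.\<close>

lemma independent_basis_coeff: "tpoly.independent (basis_coeff ` (splittings \<times> monomials))"
proof (rule tpoly.independent_if_scalars_zero)
  let ?S = "splittings \<times> monomials"
  have fin: "finite ?S"
    by (simp add: splittings_def finite_monomials)
  then show "finite (basis_coeff ` ?S)"
    by simp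
  fix c x assume 0: "(\<Sum>x\<in>basis_coeff ` ?S. mconst (c x) * x) = 0" and "x \<in> basis_coeff ` ?S"
  then obtain i j k l u v where P: "(i, j, k, l) \<in> splittings"
    and x: "x = basis_coeff ((i, j, k, l), monomial u v)"
    by (auto simp: monomials_def)
  let ?b = "((i, j, k, l), monomial u v)"
  have b: "?b \<in> ?S"
    using P monomial_in_monomials by simp
  have "0 = (\<Sum>b\<in>?S. c (basis_coeff b) * dual_functional i j k l u v (basis_coeff b))"
    using arg_cong[OF 0, of "dual_functional i j k l u v"]
    unfolding sum.reindex[OF inj_on_basis_coeff] comp_def dual_functional_linear
    by (simp add: dual_functional_def Let_def)
  also have "\<dots> = (\<Sum>b\<in>?S. if b = ?b then 4 * c (basis_coeff b) else 0)"
    by (intro sum.cong refl) (auto simp: dual_functional_basis_coeff[OF P] split: if_splits)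
  also have "\<dots> = 4 * c x"
    using b fin by (simp add: x)
  finally show "c x = 0"
    by simp
qed

section \<open>Counting the basis\<close>

text \<open>A monomial is a pair of exponent triples, each with sum 3, and there are ten such
  triples.\<close>

lemma card_monomials: "card monomials = 100"
proof -
  define cnt :: "(3 \<Rightarrow> 3) \<Rightarrow> nat \<times> nat \<times> nat" where
    "cnt r = (card {p. r p = 1}, card {p. r p = 2}, card {p. r p = 3})" for r
  define H :: "(3 + 3 \<Rightarrow>\<^sub>0 nat) \<Rightarrow> _" where
    "H m = ((Poly_Mapping.lookup m (Inl 1), Poly_Mapping.lookup m (Inl 2), Poly_Mapping.lookup m (Inl 3)),
      (Poly_Mapping.lookup m (Inr 1), Poly_Mapping.lookup m (Inr 2), Poly_Mapping.lookup m (Inr 3)))" for m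
  have H: "H (monomial r s) = (cnt r, cnt s)" for r s
    by (simp add: H_def cnt_def lookup_monomial)
  have "inj_on H monomials"
    by (rule inj_onI) (auto simp: monomials_def H cnt_def monomial_eq_iff forall_3)
  then have "card monomials = card (H ` monomials)"
    by (simp add: card_image)
  also have "H ` monomials = range cnt \<times> range cnt"
    by (force simp: monomials_def image_iff H)
  finally have card: "card monomials = card (range cnt) * card (range cnt)"
    by (simp add: card_cartesian_product)
  \<comment> \<open>The multiplicity of \<open>t\<close> in a triple of values. Replacing functions
    by triples reduces the range of \<open>cnt\<close> to an enumeration of 27 cases.\<close>
  define tri where "tri = (\<lambda>(x, y, z). (\<lambda>t::3. of_bool (x = t) + of_bool (y = t) + of_bool (z = t) :: nat))"
  have cnt: "cnt r = (tri (r 1, r 2, r 3) 1, tri (r 1, r 2, r 3) 2, tri (r 1, r 2, r 3) 3)" for r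
  proof -
    have "card {p. r p = t} = (\<Sum>p\<in>UNIV. of_bool (r p = t))" for t
      by simp
    then show ?thesis
      by (simp only: cnt_def tri_def sum_3 split)
  qed
  have "range cnt = (\<lambda>w. (tri w 1, tri w 2, tri w 3)) ` UNIV"
  proof
    show "range cnt \<subseteq> range (\<lambda>w. (tri w 1, tri w 2, tri w 3))"
      by (auto simp: cnt)
    show "range (\<lambda>w. (tri w 1, tri w 2, tri w 3)) \<subseteq> range cnt"
    proof (rule image_subsetI)
      fix w :: "3 \<times> 3 \<times> 3"
      obtain x y z where w: "w = (x, y, z)"
        by (metis surj_pair)
      have "cnt (\<lambda>p. if p = 1 then x else if p = 2 then y else z) = (tri w 1, tri w 2, tri w 3)"
        by (simp add: cnt w)
      then show "(tri w 1, tri w 2, tri w 3) \<in> range cnt"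
        by (intro range_eqI) (rule sym)
    qed
  qed
  also have "\<dots> = {(3,0,0), (2,1,0), (2,0,1), (1,2,0), (1,1,1), (1,0,2), (0,3,0), (0,2,1), (0,1,2), (0,0,3)}"
    (is "_ = ?E")
  proof
    show "range (\<lambda>w. (tri w 1, tri w 2, tri w 3)) \<subseteq> ?E"
    proof (rule image_subsetI)
      fix w :: "3 \<times> 3 \<times> 3"
      obtain x y z where w: "w = (x, y, z)"
        by (metis surj_pair)
      show "(tri w 1, tri w 2, tri w 3) \<in> ?E"
        using exhaust_3[of x] exhaust_3[of y] exhaust_3[of z]
        by (elim disjE) (simp_all add: w tri_def)
    qed
    have ex_3: "(\<exists>x::3. P x) \<longleftrightarrow> P 1 \<or> P 2 \<or> P 3" for P
      by (metis exhaust_3)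
    show "?E \<subseteq> range (\<lambda>w. (tri w 1, tri w 2, tri w 3))"
      by (simp add: image_iff split_paired_Ex ex_3 tri_def)
  qed
  finally have "card (range cnt) = 10"
    by simp
  with card show ?thesis
    by simp
qed

lemma dim_S3_S3_S111_S111: "tpoly.dim S3_S3_S111_S111 = 600"
proof -
  have "card splittings = 6"
    by (simp add: splittings_def)
  then have "card (basis_coeff ` (splittings \<times> monomials)) = 600"
    by (simp add: card_image[OF inj_on_basis_coeff] card_cartesian_product card_monomials)
  then show ?thesis
    using tpoly.dim_span_eq_card_independent[OF independent_basis_coeff] by (simp add: span_basis_coeff)
qed

theorem proposition5p3:
  fixes Q :: tensor and B :: "tensor_poly set"
  assumes "quadrifocal Q"
    and "tpoly.independent B" and "tpoly.span B = S3_S3_S111_S111"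
  shows "G_submodule S3_S3_S111_S111 \<and> S3_S3_S111_S111 \<subseteq> cubic_forms
    \<and> card B = 600 \<and> (\<forall>f\<in>B. meval f Q = 0)"
proof (intro conjI ballI)
  \<comment> \<open>All bases have the same cardinality, so the count for the coefficients found
    above carries over to \<open>B\<close>.\<close>
  show "card B = 600"
    using tpoly.dim_span_eq_card_independent[OF assms(2)] dim_S3_S3_S111_S111 by (simp add: assms(3))
  show "meval f Q = 0" if "f \<in> B" for f
    using S3_S3_S111_S111_quadrifocal[OF assms(1)] tpoly.span_base[OF that] by (simp add: assms(3))
qed (rule G_submodule_S3_S3_S111_S111 S3_S3_S111_S111_cubic)+

end
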